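(* Let $d, N$ be integers with $d \geq 2$ and $N \geq d$, let $0 < c_1 < c_2$ be real numbers, and let $\sigma \geq 0$. Then there exists an extremal vector system $(v_i)_{i=1}^N \subset \mathbb{R}^d$, i.e. one which attains the maximum $$\max_{\substack{v_1, \ldots, v_N \in \mathbb{R}^d \\ c_1 \leq |v_i|^2 \leq c_2 \ \forall i}} \ \min_{1 \leq k \leq N} \log\left(1 + \frac{|v_k|^2}{\sigma^2 + \sum_{l \neq k} \langle v_k, v_l \rangle^2}\right),$$ containing at most $$d\, \frac{2\sigma^2 + 2c_2^2 - c_1^2}{c_1^2}$$ vectors (counted by index $i$) of norm strictly larger than $\sqrt{c_1}$.
   Context: $|\cdot|$ and $\langle \cdot,\cdot\rangle$ are the Euclidean norm and inner product on $\mathbb{R}^d$. Sums $\sum_{l \neq k}$ run over $l \in \{1,\ldots,N\}\setminus\{k\}$. Convention: a positive number divided by $0$ equals $+\infty$, and $\log(+\infty)=+\infty$. The logarithm is taken to any fixed base greater than $1$. Vector systems are indexed families (repetitions are allowed). *)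

theory Defs
  imports "HOL-Analysis.Analysis"
begin

(* Only used at arguments at least 1; the finite branch is a junk value at nonpositive x. *)
definition ereal_log :: "real \<Rightarrow> ereal \<Rightarrow> ereal" where
  "ereal_log b x = (if x = \<infinity> then \<infinity> else ereal (log b (real_of_ereal x)))"

(* The quotient is taken in ereal, where a positive number divided by 0 is \<infinity>. *)
definition vector_rate ::
  "real \<Rightarrow> real \<Rightarrow> nat \<Rightarrow> (nat \<Rightarrow> real ^ 'd) \<Rightarrow> nat \<Rightarrow> ereal" where
  "vector_rate b \<sigma> N v k =
     ereal_log b (1 + ereal ((norm (v k))\<^sup>2) /
                      ereal (\<sigma>\<^sup>2 + (\<Sum>l\<in>{1..N} - {k}. (v k \<bullet> v l)\<^sup>2)))"

definition min_rate :: "real \<Rightarrow> real \<Rightarrow> nat \<Rightarrow> (nat \<Rightarrow> real ^ 'd) \<Rightarrow> ereal" where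
  "min_rate b \<sigma> N v = (MIN k\<in>{1..N}. vector_rate b \<sigma> N v k)"

(* A system of N vectors is a function on nat of which only the values on {1..N} matter. *)
definition admissible_system ::
  "real \<Rightarrow> real \<Rightarrow> nat \<Rightarrow> (nat \<Rightarrow> real ^ 'd) \<Rightarrow> bool" where
  "admissible_system c1 c2 N v \<longleftrightarrow>
     (\<forall>i\<in>{1..N}. c1 \<le> (norm (v i))\<^sup>2 \<and> (norm (v i))\<^sup>2 \<le> c2)"

definition extremal_system ::
  "real \<Rightarrow> real \<Rightarrow> real \<Rightarrow> real \<Rightarrow> nat \<Rightarrow> (nat \<Rightarrow> real ^ 'd) \<Rightarrow> bool" where
  "extremal_system b \<sigma> c1 c2 N v \<longleftrightarrow>
     is_arg_max (min_rate b \<sigma> N) (admissible_system c1 c2 N) v"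

end

theory Submission
  imports Defs
begin

text \<open>
  Among the extremal systems, which form a compact set up to irrelevant indices, choose one of least
  total energy \<open>\<Sum> |v\<^sub>i|\<^sup>2\<close>, and let \<open>K\<close> be its set of vectors longer than \<open>sqrt c1\<close>.
  If every \<open>l\<close> in a nonempty \<open>J \<subseteq> K\<close> receives interference more than \<open>\<sigma>\<^sup>2\<close> from the rest of \<open>J\<close>,
  then shrinking all vectors of \<open>J\<close> by a common factor close to 1 lowers no rate, since the loss of
  signal against the noise is outweighed by the loss of interference. That contradicts minimality.
  Hence no such \<open>J\<close> exists, and removing indices one by one gives
  \<open>\<Sum>\<^bsub>k\<noteq>l\<in>K\<^esub> \<langle>v\<^sub>k, v\<^sub>l\<rangle>\<^sup>2 \<le> 2 \<sigma>\<^sup>2 |K|\<close>. On the other hand the frame potential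
  \<open>\<Sum>\<^bsub>k,l\<in>K\<^esub> \<langle>v\<^sub>k, v\<^sub>l\<rangle>\<^sup>2\<close> is at least \<open>(\<Sum>\<^bsub>k\<in>K\<^esub> |v\<^sub>k|\<^sup>2)\<^sup>2 / d\<close>,
  which is quadratic in \<open>|K|\<close>.
\<close>

section \<open>Frame potential, row sums and finite maxima\<close>

text \<open>The potential is the squared Frobenius norm of the frame operator with entries
  \<open>S i j\<close>, and the squared norms add up to its trace. Cauchy-Schwarz on the diagonal
  gives the factor \<open>CARD('d)\<close>; the off-diagonal squares only enlarge the right-hand
  side.\<close>

lemma frame_potential_ge:
  fixes v :: "'i \<Rightarrow> real ^ 'd"
  shows "(\<Sum>k\<in>K. (norm (v k))\<^sup>2)\<^sup>2 \<le> real CARD('d) * (\<Sum>k\<in>K. \<Sum>l\<in>K. (v k \<bullet> v l)\<^sup>2)"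
proof -
  define S where "S i j = (\<Sum>k\<in>K. v k $ i * v k $ j)" for i j
  have "(\<Sum>k\<in>K. \<Sum>l\<in>K. (v k \<bullet> v l)\<^sup>2)
      = (\<Sum>k\<in>K. \<Sum>l\<in>K. \<Sum>i\<in>UNIV. \<Sum>j\<in>UNIV. (v k $ i * v k $ j) * (v l $ i * v l $ j))"
    by (simp add: inner_vec_def power2_eq_square sum_product mult_ac)
  also have "\<dots> = (\<Sum>i\<in>UNIV. \<Sum>j\<in>UNIV. \<Sum>k\<in>K. \<Sum>l\<in>K. (v k $ i * v k $ j) * (v l $ i * v l $ j))"
    by (simp only: sum.swap[where A = K and B = "UNIV :: 'd set"])
  also have "\<dots> = (\<Sum>i\<in>UNIV. \<Sum>j\<in>UNIV. (S i j)\<^sup>2)"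
    by (simp add: S_def power2_eq_square sum_product)
  finally have potential: "(\<Sum>k\<in>K. \<Sum>l\<in>K. (v k \<bullet> v l)\<^sup>2) = (\<Sum>i\<in>UNIV. \<Sum>j\<in>UNIV. (S i j)\<^sup>2)" .
  have "(\<Sum>k\<in>K. (norm (v k))\<^sup>2) = (\<Sum>k\<in>K. \<Sum>i\<in>UNIV. v k $ i * v k $ i)"
    by (simp add: power2_norm_eq_inner inner_vec_def)
  also have "\<dots> = (\<Sum>i\<in>UNIV. S i i)"
    unfolding S_def by (rule sum.swap)
  finally have "(\<Sum>k\<in>K. (norm (v k))\<^sup>2)\<^sup>2 \<le> real CARD('d) * (\<Sum>i\<in>UNIV. (S i i)\<^sup>2)"
    using sum_squared_le_sum_of_squares[of "\<lambda>i. S i i" "UNIV :: 'd set"]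
    by (simp add: mult.commute)
  also have "\<dots> \<le> real CARD('d) * (\<Sum>i\<in>UNIV. \<Sum>j\<in>UNIV. (S i j)\<^sup>2)"
    by (intro mult_left_mono sum_mono member_le_sum) auto
  finally show ?thesis
    by (simp add: potential)
qed

text \<open>Indices with row sum at most \<open>c\<close> are removed one at a time. By symmetry
  each removal lowers the total by at most \<open>2 * c\<close>, so the strict excess over
  \<open>2 * c * card K\<close> persists. On the empty set it would read \<open>0 < 0\<close>, hence
  the process stops earlier.\<close>

lemma exists_subset_rows_greater:
  fixes a :: "'i \<Rightarrow> 'i \<Rightarrow> real"
  assumes "finite K" and sym: "\<And>k l. a k l = a l k"
    and "2 * c * real (card K) < (\<Sum>k\<in>K. \<Sum>l\<in>K - {k}. a k l)"
  shows "\<exists>J\<subseteq>K. J \<noteq> {} \<and> (\<forall>k\<in>J. c < (\<Sum>l\<in>J - {k}. a k l))"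
  using assms(1,3)
proof (induction K rule: finite_psubset_induct)
  case (psubset K)
  show ?case
  proof (cases "\<forall>k\<in>K. c < (\<Sum>l\<in>K - {k}. a k l)")
    case True
    moreover have "K \<noteq> {}"
      using psubset.prems by auto
    ultimately show ?thesis
      by blast
  next
    case False
    then obtain m where m: "m \<in> K" "(\<Sum>l\<in>K - {m}. a m l) \<le> c"
      by force
    \<comment> \<open>Deleting \<open>m\<close> takes away its row and its column; symmetry makes
      the two sums equal, whence the factor 2 below.\<close>
    have "(\<Sum>k\<in>K. \<Sum>l\<in>K - {k}. a k l)
        = (\<Sum>l\<in>K - {m}. a m l) + (\<Sum>k\<in>K - {m}. \<Sum>l\<in>K - {k}. a k l)"
      by (rule sum.remove[OF psubset.hyps m(1)])
    also have "(\<Sum>k\<in>K - {m}. \<Sum>l\<in>K - {k}. a k l)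
        = (\<Sum>k\<in>K - {m}. a k m + (\<Sum>l\<in>K - {m} - {k}. a k l))"
    proof (rule sum.cong[OF refl])
      fix k assume "k \<in> K - {m}"
      then have "m \<in> K - {k}"
        using m by auto
      then have "(\<Sum>l\<in>K - {k}. a k l) = a k m + (\<Sum>l\<in>K - {k} - {m}. a k l)"
        using psubset.hyps by (intro sum.remove) auto
      also have "K - {k} - {m} = K - {m} - {k}"
        by auto
      finally show "(\<Sum>l\<in>K - {k}. a k l) = a k m + (\<Sum>l\<in>K - {m} - {k}. a k l)" .
    qed
    also have "\<dots> = (\<Sum>l\<in>K - {m}. a m l) + (\<Sum>k\<in>K - {m}. \<Sum>l\<in>K - {m} - {k}. a k l)"
      by (simp add: sum.distrib sym[of _ m])
    finally have split: "(\<Sum>k\<in>K. \<Sum>l\<in>K - {k}. a k l)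
      = 2 * (\<Sum>l\<in>K - {m}. a m l) + (\<Sum>k\<in>K - {m}. \<Sum>l\<in>K - {m} - {k}. a k l)"
      by simp
    have "real (card K) = real (card (K - {m})) + 1"
      by (simp add: card.remove[OF psubset.hyps m(1)] del: card_Diff_insert)
    then have "2 * c * real (card (K - {m})) < (\<Sum>k\<in>K - {m}. \<Sum>l\<in>K - {m} - {k}. a k l)"
      using psubset.prems split m(2) by (simp add: algebra_simps)
    then obtain J where "J \<subseteq> K - {m}" "J \<noteq> {}" "\<forall>k\<in>J. c < (\<Sum>l\<in>J - {k}. a k l)"
      using psubset.IH[of "K - {m}"] m by blast
    then show ?thesis
      by blast
  qed
qed

lemma continuous_on_Max_image:
  fixes f :: "'i \<Rightarrow> 'a::topological_space \<Rightarrow> real"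
  assumes "finite I" "I \<noteq> {}" "\<And>i. i \<in> I \<Longrightarrow> continuous_on S (f i)"
  shows "continuous_on S (\<lambda>x. MAX i\<in>I. f i x)"
  using assms
proof (induction I rule: finite_ne_induct)
  case (insert i I)
  then have "continuous_on S (\<lambda>x. max (f i x) (MAX i\<in>I. f i x))"
    by (intro continuous_on_max) auto
  then show ?case
    using insert by simp
qed simp

section \<open>Reciprocal rates and extremality\<close>

text \<open>The reciprocal of the signal to interference-plus-noise ratio. It is real-valued, and
  continuous where the vectors are nonzero, with 0 standing for an infinite rate, so the compactness
  argument can stay outside \<open>ereal\<close>.\<close>

definition inverse_rate :: "real \<Rightarrow> nat \<Rightarrow> (nat \<Rightarrow> real ^ 'd) \<Rightarrow> nat \<Rightarrow> real" where
  "inverse_rate \<sigma> N v k = (\<sigma>\<^sup>2 + (\<Sum>l\<in>{1..N} - {k}. (v k \<bullet> v l)\<^sup>2)) / (norm (v k))\<^sup>2"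

definition max_inverse_rate :: "real \<Rightarrow> nat \<Rightarrow> (nat \<Rightarrow> real ^ 'd) \<Rightarrow> real" where
  "max_inverse_rate \<sigma> N v = (MAX k\<in>{1..N}. inverse_rate \<sigma> N v k)"

definition energy :: "nat \<Rightarrow> (nat \<Rightarrow> real ^ 'd) \<Rightarrow> real" where
  "energy N v = (\<Sum>i\<in>{1..N}. (norm (v i))\<^sup>2)"

text \<open>The value 0 is a separate case because the real quotient \<open>1 / 0\<close> is 0,
  whereas the rate there is infinite.\<close>

lemma vector_rate_eq:
  assumes "v k \<noteq> 0"
  shows "vector_rate b \<sigma> N v k =
    (if inverse_rate \<sigma> N v k = 0 then \<infinity> else ereal (log b (1 + 1 / inverse_rate \<sigma> N v k)))"
proof -
  define q where "q = \<sigma>\<^sup>2 + (\<Sum>l\<in>{1..N} - {k}. (v k \<bullet> v l)\<^sup>2)"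
  have a: "0 < (norm (v k))\<^sup>2"
    using assms by simp
  show ?thesis
  proof (cases "q = 0")
    case True
    then show ?thesis
      using a unfolding vector_rate_def inverse_rate_def ereal_log_def q_def[symmetric]
      by (simp add: divide_ereal_def)
  next
    case False
    then show ?thesis
      using a unfolding vector_rate_def inverse_rate_def ereal_log_def q_def[symmetric]
      by (simp add: one_ereal_def)
  qed
qed

lemma inverse_rate_nonneg: "0 \<le> inverse_rate \<sigma> N v k"
  unfolding inverse_rate_def by (intro divide_nonneg_nonneg add_nonneg_nonneg sum_nonneg) auto

lemma vector_rate_antimono:
  assumes "1 < b" "v k \<noteq> 0" "w l \<noteq> 0" "inverse_rate \<sigma> N v k \<le> inverse_rate \<sigma> N w l"
  shows "vector_rate b \<sigma> N w l \<le> vector_rate b \<sigma> N v k"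
proof (cases "inverse_rate \<sigma> N v k = 0")
  case True
  then show ?thesis
    using assms by (simp add: vector_rate_eq)
next
  case False
  then have "0 < inverse_rate \<sigma> N v k"
    using inverse_rate_nonneg[of \<sigma> N v k] by simp
  with assms show ?thesis
    by (auto simp: vector_rate_eq add_pos_pos intro!: frac_le)
qed

lemma inverse_rate_le_max:
  assumes "k \<in> {1..N}"
  shows "inverse_rate \<sigma> N v k \<le> max_inverse_rate \<sigma> N v"
  unfolding max_inverse_rate_def using assms by (intro Max_ge) auto

lemma max_inverse_rate_mono:
  assumes "1 \<le> N" "\<And>k. k \<in> {1..N} \<Longrightarrow> inverse_rate \<sigma> N w k \<le> inverse_rate \<sigma> N v k"
  shows "max_inverse_rate \<sigma> N w \<le> max_inverse_rate \<sigma> N v"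
proof -
  have "inverse_rate \<sigma> N w k \<le> max_inverse_rate \<sigma> N v" if "k \<in> {1..N}" for k
    using assms(2)[OF that] inverse_rate_le_max[OF that] by (rule order_trans)
  then show ?thesis
    unfolding max_inverse_rate_def[of \<sigma> N w] using assms(1) by (intro Max.boundedI) auto
qed

lemma admissible_system_nonzero:
  assumes "0 < c1" "admissible_system c1 c2 N v" "k \<in> {1..N}"
  shows "v k \<noteq> 0"
  using assms unfolding admissible_system_def by fastforce

text \<open>At the index \<open>l\<close> where \<open>w\<close> is worst, the inverse rate of
  \<open>w\<close> dominates all those of \<open>v\<close>. So every rate of \<open>v\<close> is at
  least the rate of \<open>w\<close> at \<open>l\<close>, which in turn is at least
  \<open>min_rate\<close> of \<open>w\<close>.\<close>

lemma min_rate_antimono: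
  assumes "1 < b" "0 < c1" "1 \<le> N" "admissible_system c1 c2 N v" "admissible_system c1 c2 N w"
    and le: "max_inverse_rate \<sigma> N v \<le> max_inverse_rate \<sigma> N w"
  shows "min_rate b \<sigma> N w \<le> min_rate b \<sigma> N v"
proof -
  have "max_inverse_rate \<sigma> N w \<in> inverse_rate \<sigma> N w ` {1..N}"
    unfolding max_inverse_rate_def using assms(3) by (intro Max_in) auto
  then obtain l where l: "l \<in> {1..N}" "max_inverse_rate \<sigma> N w = inverse_rate \<sigma> N w l"
    by blast
  have "min_rate b \<sigma> N w \<le> vector_rate b \<sigma> N v k" if k: "k \<in> {1..N}" for k
  proof -
    have "vector_rate b \<sigma> N w l \<le> vector_rate b \<sigma> N v k"
      using assms l k inverse_rate_le_max[OF k, of \<sigma> v]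
      by (intro vector_rate_antimono admissible_system_nonzero[of c1 c2 N]) auto
    moreover have "min_rate b \<sigma> N w \<le> vector_rate b \<sigma> N w l"
      unfolding min_rate_def using l by (intro Min_le) auto
    ultimately show ?thesis
      by simp
  qed
  then show ?thesis
    unfolding min_rate_def[of b \<sigma> N v] using assms(3) by (subst Min_ge_iff) auto
qed

lemma extremal_systemI:
  fixes v :: "nat \<Rightarrow> real ^ 'd"
  assumes "1 < b" "0 < c1" "1 \<le> N" "admissible_system c1 c2 N v"
    and "\<And>w :: nat \<Rightarrow> real ^ 'd. admissible_system c1 c2 N w
           \<Longrightarrow> max_inverse_rate \<sigma> N v \<le> max_inverse_rate \<sigma> N w"
  shows "extremal_system b \<sigma> c1 c2 N v"
proof -
  have "min_rate b \<sigma> N w \<le> min_rate b \<sigma> N v"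
    if "admissible_system c1 c2 N w" for w :: "nat \<Rightarrow> real ^ 'd"
    using min_rate_antimono[OF assms(1-4) that assms(5)[OF that]] .
  then show ?thesis
    unfolding extremal_system_def is_arg_max_def using assms(4) by (auto simp: not_less)
qed

section \<open>Compactness and the choice of a minimizer\<close>

text \<open>Two successive minimizations over compact sets: the largest inverse rate over normalized
  admissible systems, then the energy over the set of minimizers.\<close>

lemma exists_least_energy_minimizer:
  fixes c1 c2 \<sigma> :: real
  assumes "0 < c1" "c1 < c2" "1 \<le> N"
  obtains v :: "nat \<Rightarrow> real ^ 'd" where "admissible_system c1 c2 N v"
    and "\<And>w :: nat \<Rightarrow> real ^ 'd. admissible_system c1 c2 N w
           \<Longrightarrow> max_inverse_rate \<sigma> N v \<le> max_inverse_rate \<sigma> N w"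
    and "\<And>w :: nat \<Rightarrow> real ^ 'd. admissible_system c1 c2 N w
           \<Longrightarrow> max_inverse_rate \<sigma> N w \<le> max_inverse_rate \<sigma> N v \<Longrightarrow> energy N v \<le> energy N w"
proof -
  define A where "A = {x :: real ^ 'd. c1 \<le> (norm x)\<^sup>2 \<and> (norm x)\<^sup>2 \<le> c2}"
  \<comment> \<open>Systems are functions on all of \<open>nat\<close>. Pinning the coordinates
    outside \<open>{1..N}\<close> to 0 makes every factor, hence the product, compact.\<close>
  define C where "C = (\<Pi>\<^sub>E i\<in>(UNIV :: nat set). if i \<in> {1..N} then A else {0})"
  \<comment> \<open>\<open>restr\<close> sends every admissible system into \<open>C\<close> and
    changes neither objective, so minimality within \<open>C\<close> extends to all admissible
    systems.\<close>
  define restr :: "(nat \<Rightarrow> real ^ 'd) \<Rightarrow> nat \<Rightarrow> real ^ 'd"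
    where "restr w i = (if i \<in> {1..N} then w i else 0)" for w i
  have adm: "admissible_system c1 c2 N v" if "v \<in> C" for v
    unfolding admissible_system_def
  proof
    fix i assume "i \<in> {1..N}"
    then show "c1 \<le> (norm (v i))\<^sup>2 \<and> (norm (v i))\<^sup>2 \<le> c2"
      using that PiE_mem[of v UNIV "\<lambda>i. if i \<in> {1..N} then A else {0}" i]
      by (simp add: C_def A_def)
  qed
  have restr_C: "restr w \<in> C" if "admissible_system c1 c2 N w" for w :: "nat \<Rightarrow> real ^ 'd"
    using that by (auto simp: C_def A_def restr_def admissible_system_def)
  have restr_rate: "max_inverse_rate \<sigma> N (restr w) = max_inverse_rate \<sigma> N w" for w
    unfolding max_inverse_rate_def
    by (intro arg_cong[of _ _ Max] image_cong refl) (simp add: inverse_rate_def restr_def)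
  have restr_energy: "energy N (restr w) = energy N w" for w
    by (simp add: energy_def restr_def)
  obtain u :: "real ^ 'd" where u: "norm u = sqrt c1"
    using vector_choose_size[of "sqrt c1"] assms by auto
  have "restr (\<lambda>_. u) \<in> C"
    using u assms by (intro restr_C) (simp add: admissible_system_def)
  then have ne: "C \<noteq> {}"
    by blast
  have "closed A"
    unfolding A_def by (intro closed_Collect_conj closed_Collect_le continuous_intros)
  moreover have "bounded A"
    unfolding A_def by (intro boundedI[of _ "sqrt c2"]) (auto intro: real_le_rsqrt)
  ultimately have "compact A"
    by (simp add: compact_eq_bounded_closed)
  then have "compactin (product_topology (\<lambda>_. euclidean) UNIV) C"
    unfolding C_def by (subst compactin_PiE) auto
  then have compact_C: "compact C"
    by (simp add: euclidean_product_topology)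
  have coord: "continuous_on C (\<lambda>v. v i)" for i
    by (rule continuous_on_subset[OF continuous_on_product_coordinates]) simp
  have cont_rate: "continuous_on C (max_inverse_rate \<sigma> N)"
    unfolding max_inverse_rate_def inverse_rate_def
  proof (intro continuous_on_Max_image)
    fix k assume k: "k \<in> {1..N}"
    have "v k \<noteq> 0" if "v \<in> C" for v
      using admissible_system_nonzero[OF assms(1) adm[OF that] k] .
    then show "continuous_on C
        (\<lambda>v. (\<sigma>\<^sup>2 + (\<Sum>l\<in>{1..N} - {k}. (v k \<bullet> v l)\<^sup>2)) / (norm (v k))\<^sup>2)"
      by (intro continuous_intros coord) simp
  qed (use assms in auto)
  obtain m where m: "m \<in> C" "\<And>w. w \<in> C \<Longrightarrow> max_inverse_rate \<sigma> N m \<le> max_inverse_rate \<sigma> N w"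
    using continuous_attains_inf[OF compact_C ne cont_rate] by blast
  \<comment> \<open>Since \<open>m\<close> is a minimizer, the inequality describes exactly the
    minimizers in \<open>C\<close>, and does so by a closed condition.\<close>
  define E where "E = {v \<in> C. max_inverse_rate \<sigma> N v \<le> max_inverse_rate \<sigma> N m}"
  have "closed E"
    unfolding E_def
    by (intro continuous_on_closed_Collect_le compact_imp_closed compact_C cont_rate
        continuous_on_const)
  then have "compact (C \<inter> E)"
    by (intro compact_Int_closed compact_C)
  moreover have "C \<inter> E = E"
    by (auto simp: E_def)
  ultimately have "compact E"
    by simp
  moreover have "m \<in> E"
    using m by (simp add: E_def)
  moreover have "continuous_on E (energy N)"
    unfolding energy_def
    by (intro continuous_intros continuous_on_subset[OF coord]) (auto simp: E_def)
  ultimately obtain v where v: "v \<in> E" "\<And>w. w \<in> E \<Longrightarrow> energy N v \<le> energy N w"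
    using continuous_attains_inf[of E "energy N"] by blast
  show thesis
  proof
    show "admissible_system c1 c2 N v"
      using v adm by (simp add: E_def)
    show least: "max_inverse_rate \<sigma> N v \<le> max_inverse_rate \<sigma> N w"
      if "admissible_system c1 c2 N w" for w :: "nat \<Rightarrow> real ^ 'd"
      using v(1) m(2)[OF restr_C[OF that]] by (simp add: E_def restr_rate)
    show "energy N v \<le> energy N w"
      if "admissible_system c1 c2 N w"
        "max_inverse_rate \<sigma> N w \<le> max_inverse_rate \<sigma> N v" for w :: "nat \<Rightarrow> real ^ 'd"
    proof -
      have "restr w \<in> E"
        using v(1) that restr_C by (simp add: E_def restr_rate)
      then show ?thesis
        using v(2) restr_energy by metis
    qed
  qed
qed

section \<open>Shrinking a subsystem\<close>

text \<open>Each strict inequality survives multiplication by any \<open>s\<close> close enough to 1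
  from below, and finiteness of \<open>J\<close> allows one \<open>s\<close> for all
  indices.\<close>

lemma exists_shrink_factor:
  fixes x y :: "'i \<Rightarrow> real"
  assumes "finite J" and "\<And>i. i \<in> J \<Longrightarrow> 0 \<le> y i \<and> y i < x i"
  obtains s where "0 < s" "s < 1" "\<And>i. i \<in> J \<Longrightarrow> y i \<le> s * x i"
proof -
  have "\<forall>\<^sub>F s in at_left 1. y i \<le> s * x i" if "i \<in> J" for i
  proof -
    have "((\<lambda>s. s * x i) \<longlongrightarrow> 1 * x i) (at_left 1)"
      by (intro tendsto_intros)
    then have "\<forall>\<^sub>F s in at_left 1. y i < s * x i"
      using assms(2)[OF that] by (intro order_tendstoD(1)) auto
    then show ?thesis
      by eventually_elim simp
  qed
  then have "\<forall>\<^sub>F s in at_left 1. \<forall>i\<in>J. y i \<le> s * x i"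
    using assms(1) by (simp add: eventually_ball_finite)
  moreover have "\<forall>\<^sub>F s :: real in at_left 1. 0 < s \<and> s < 1"
    using eventually_at_left_real[of 0 "1::real"] by simp
  ultimately have "\<forall>\<^sub>F s in at_left 1. 0 < s \<and> s < 1 \<and> (\<forall>i\<in>J. y i \<le> s * x i)"
    by eventually_elim simp
  then show ?thesis
    using that eventually_happens'[OF trivial_limit_at_left_real[of 1]] by blast
qed

text \<open>Outside \<open>J\<close> interference can only fall. Inside \<open>J\<close>, dividing
  by the weaker signal raises the noise term by \<open>(1 - s) * (\<sigma>\<^sup>2 / s)\<close>,
  while the interference term falls by \<open>1 - s\<close> times the interference from
  \<open>J\<close>, which is at least \<open>\<sigma>\<^sup>2 / s\<close>.\<close>

lemma inverse_rate_shrink_le: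
  fixes v :: "nat \<Rightarrow> real ^ 'd"
  assumes J: "J \<subseteq> {1..N}" and s: "0 < s" "s < 1"
    and strong: "\<And>k. k \<in> J \<Longrightarrow> \<sigma>\<^sup>2 \<le> s * (\<Sum>l\<in>J - {k}. (v k \<bullet> v l)\<^sup>2)"
  shows "inverse_rate \<sigma> N (\<lambda>i. if i \<in> J then sqrt s *\<^sub>R v i else v i) k \<le> inverse_rate \<sigma> N v k"
proof -
  define w where "w i = (if i \<in> J then sqrt s *\<^sub>R v i else v i)" for i
  \<comment> \<open>\<open>q i\<close> is the factor on the squared norm of vector \<open>i\<close>;
    \<open>R\<close> is the interference at \<open>k\<close> from the shrunken vectors, with
    \<open>v k\<close> itself left unscaled.\<close>
  define q where "q i = (if i \<in> J then s else 1)" for i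
  define R where "R = (\<Sum>l\<in>{1..N} - {k}. q l * (v k \<bullet> v l)\<^sup>2)"
  have q: "0 < q i" "q i \<le> 1" for i
    using s by (auto simp: q_def)
  have inner_w: "(w i \<bullet> w l)\<^sup>2 = q i * (q l * (v i \<bullet> v l)\<^sup>2)" for i l
    using s by (simp add: w_def q_def power_mult_distrib)
  have norm_w: "(norm (w i))\<^sup>2 = q i * (norm (v i))\<^sup>2" for i
    using s by (simp add: w_def q_def power_mult_distrib)
  have "inverse_rate \<sigma> N w k = (\<sigma>\<^sup>2 + q k * R) / (q k * (norm (v k))\<^sup>2)"
    unfolding inverse_rate_def inner_w norm_w by (simp add: R_def sum_distrib_left)
  \<comment> \<open>The factor \<open>q k\<close> cancels between signal and interference, leaving
    only the noise divided by it.\<close>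
  also have "\<dots> = (\<sigma>\<^sup>2 / q k + R) / (norm (v k))\<^sup>2"
    using q(1)[of k] by (simp add: field_simps)
  also have "\<dots> \<le> (\<sigma>\<^sup>2 + (\<Sum>l\<in>{1..N} - {k}. (v k \<bullet> v l)\<^sup>2)) / (norm (v k))\<^sup>2"
  proof (intro divide_right_mono)
    show "\<sigma>\<^sup>2 / q k + R \<le> \<sigma>\<^sup>2 + (\<Sum>l\<in>{1..N} - {k}. (v k \<bullet> v l)\<^sup>2)"
    proof (cases "k \<in> J")
      case True
      define r where "r = (\<Sum>l\<in>J - {k}. (v k \<bullet> v l)\<^sup>2)"
      have "(\<Sum>l\<in>{1..N} - {k}. (v k \<bullet> v l)\<^sup>2) - R
          = (\<Sum>l\<in>{1..N} - {k}. if l \<in> J then (1 - s) * (v k \<bullet> v l)\<^sup>2 else 0)"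
        unfolding R_def sum_subtractf[symmetric]
        by (intro sum.cong) (auto simp: q_def algebra_simps)
      also have "\<dots> = (\<Sum>l\<in>({1..N} - {k}) \<inter> J. (1 - s) * (v k \<bullet> v l)\<^sup>2)"
        by (simp add: sum.inter_restrict)
      also have "({1..N} - {k}) \<inter> J = J - {k}"
        using J by auto
      finally have gain: "(\<Sum>l\<in>{1..N} - {k}. (v k \<bullet> v l)\<^sup>2) - R = (1 - s) * r"
        by (simp add: r_def sum_distrib_left)
      have "\<sigma>\<^sup>2 / s \<le> r"
        using strong[OF True] s by (simp add: r_def field_simps)
      then have "(1 - s) * (\<sigma>\<^sup>2 / s) \<le> (1 - s) * r"
        using s by (intro mult_left_mono) auto
      moreover have "(1 - s) * (\<sigma>\<^sup>2 / s) = \<sigma>\<^sup>2 / s - \<sigma>\<^sup>2"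
        using s by (simp add: field_simps)
      ultimately show ?thesis
        using gain True by (simp add: q_def)
    next
      case False
      moreover have "R \<le> (\<Sum>l\<in>{1..N} - {k}. (v k \<bullet> v l)\<^sup>2)"
        unfolding R_def using q by (intro sum_mono mult_left_le_one_le) (auto intro: less_imp_le)
      ultimately show ?thesis
        by (simp add: q_def)
    qed
  qed simp
  finally show ?thesis
    by (simp add: inverse_rate_def w_def)
qed

section \<open>Counting the long vectors\<close>

text \<open>For \<open>n\<close> vectors the frame potential is at least
  \<open>(n * c1)\<^sup>2 / CARD('d)\<close>, while its diagonal is at most
  \<open>n * c2\<^sup>2\<close> and the rest at most \<open>2 * \<sigma>\<^sup>2 * n\<close>; one
  factor \<open>n\<close> cancels.\<close>

lemma card_le_of_small_cross_energy:
  fixes v :: "nat \<Rightarrow> real ^ 'd"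
  assumes "finite K" "0 < c1" "c1 < c2"
    and norms: "\<And>k. k \<in> K \<Longrightarrow> c1 \<le> (norm (v k))\<^sup>2 \<and> (norm (v k))\<^sup>2 \<le> c2"
    and cross: "(\<Sum>k\<in>K. \<Sum>l\<in>K - {k}. (v k \<bullet> v l)\<^sup>2) \<le> 2 * \<sigma>\<^sup>2 * real (card K)"
  shows "real (card K) \<le> real CARD('d) * ((2 * \<sigma>\<^sup>2 + 2 * c2\<^sup>2 - c1\<^sup>2) / c1\<^sup>2)"
proof -
  define n where "n = real (card K)"
  define B where "B = 2 * \<sigma>\<^sup>2 + 2 * c2\<^sup>2 - c1\<^sup>2"
  have c: "c1\<^sup>2 \<le> c2\<^sup>2" "0 < c1\<^sup>2"
    using assms by (auto intro: power_mono)
  have "n * c1 \<le> (\<Sum>k\<in>K. (norm (v k))\<^sup>2)"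
    unfolding n_def using norms by (intro sum_bounded_below) auto
  then have "(n * c1)\<^sup>2 \<le> (\<Sum>k\<in>K. (norm (v k))\<^sup>2)\<^sup>2"
    using assms(2) by (intro power_mono) (auto simp: n_def)
  also have "\<dots> \<le> real CARD('d) * (\<Sum>k\<in>K. \<Sum>l\<in>K. (v k \<bullet> v l)\<^sup>2)"
    by (rule frame_potential_ge)
  also have "\<dots> \<le> real CARD('d) * (n * B)"
  proof (intro mult_left_mono)
    have "(\<Sum>k\<in>K. \<Sum>l\<in>K. (v k \<bullet> v l)\<^sup>2)
        = (\<Sum>k\<in>K. ((norm (v k))\<^sup>2)\<^sup>2) + (\<Sum>k\<in>K. \<Sum>l\<in>K - {k}. (v k \<bullet> v l)\<^sup>2)"
      unfolding sum.distrib[symmetric]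
      by (intro sum.cong refl) (simp add: sum.remove[OF assms(1)] power2_norm_eq_inner)
    also have "(\<Sum>k\<in>K. ((norm (v k))\<^sup>2)\<^sup>2) \<le> n * c2\<^sup>2"
      unfolding n_def using norms by (intro sum_bounded_above power_mono) auto
    finally have "(\<Sum>k\<in>K. \<Sum>l\<in>K. (v k \<bullet> v l)\<^sup>2) \<le> n * (c2\<^sup>2 + 2 * \<sigma>\<^sup>2)"
      using cross by (simp add: n_def algebra_simps)
    \<comment> \<open>\<open>B\<close> exceeds \<open>c2\<^sup>2 + 2 * \<sigma>\<^sup>2\<close> by
      \<open>c2\<^sup>2 - c1\<^sup>2\<close>, which is nonnegative.\<close>
    also have "\<dots> \<le> n * B"
      using c by (intro mult_left_mono) (auto simp: B_def n_def)
    finally show "(\<Sum>k\<in>K. \<Sum>l\<in>K. (v k \<bullet> v l)\<^sup>2) \<le> n * B" .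
  qed simp
  finally have "n * (n * c1\<^sup>2) \<le> n * (real CARD('d) * B)"
    by (simp add: power2_eq_square mult_ac)
  \<comment> \<open>This settles \<open>n = 0\<close>, where \<open>n\<close> cannot be
    cancelled.\<close>
  moreover have "0 \<le> real CARD('d) * B"
    unfolding B_def using c(1) zero_le_power2[of \<sigma>] zero_le_power2[of c2]
    by (intro mult_nonneg_nonneg of_nat_0_le_iff) linarith
  ultimately have "n * c1\<^sup>2 \<le> real CARD('d) * B"
    by (cases "n = 0") (auto simp: n_def)
  then show ?thesis
    unfolding n_def[symmetric] B_def[symmetric] using c(2) by (simp add: field_simps)
qed

section \<open>Few long vectors at least energy\<close>

theorem theorem4:
  fixes b c1 c2 \<sigma> :: real and N :: nat
  assumes "1 < b"
    and "2 \<le> CARD('d::finite)"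
    and "CARD('d) \<le> N"
    and "0 < c1" and "c1 < c2"
    and "0 \<le> \<sigma>"
  shows "\<exists>v :: nat \<Rightarrow> real ^ 'd.
           extremal_system b \<sigma> c1 c2 N v \<and>
           real (card {i \<in> {1..N}. norm (v i) > sqrt c1})
             \<le> real CARD('d) * ((2 * \<sigma>\<^sup>2 + 2 * c2\<^sup>2 - c1\<^sup>2) / c1\<^sup>2)"
proof -
  have N: "1 \<le> N"
    using assms by simp
  obtain v :: "nat \<Rightarrow> real ^ 'd" where adm: "admissible_system c1 c2 N v"
    and best: "\<And>w :: nat \<Rightarrow> real ^ 'd. admissible_system c1 c2 N w
           \<Longrightarrow> max_inverse_rate \<sigma> N v \<le> max_inverse_rate \<sigma> N w"
    and least: "\<And>w :: nat \<Rightarrow> real ^ 'd. admissible_system c1 c2 N w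
           \<Longrightarrow> max_inverse_rate \<sigma> N w \<le> max_inverse_rate \<sigma> N v \<Longrightarrow> energy N v \<le> energy N w"
    using exists_least_energy_minimizer[OF assms(4,5) N] by blast
  define K where "K = {i \<in> {1..N}. norm (v i) > sqrt c1}"
  have K: "finite K" "K \<subseteq> {1..N}"
    by (auto simp: K_def)
  \<comment> \<open>Strictness leaves room to shrink these vectors without violating the lower bound
    \<open>c1\<close>.\<close>
  have long: "c1 < (norm (v k))\<^sup>2" if "k \<in> K" for k
    using that assms(4) power_strict_mono[of "sqrt c1" "norm (v k)" 2] by (simp add: K_def)
  have "(\<Sum>k\<in>K. \<Sum>l\<in>K - {k}. (v k \<bullet> v l)\<^sup>2) \<le> 2 * \<sigma>\<^sup>2 * real (card K)"
  proof (rule ccontr)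
    assume "\<not> ?thesis"
    then obtain J where J: "J \<subseteq> K" "J \<noteq> {}"
      and strong: "\<And>k. k \<in> J \<Longrightarrow> \<sigma>\<^sup>2 < (\<Sum>l\<in>J - {k}. (v k \<bullet> v l)\<^sup>2)"
      using exists_subset_rows_greater[OF K(1), of "\<lambda>k l. (v k \<bullet> v l)\<^sup>2" "\<sigma>\<^sup>2"]
      by (auto simp: inner_commute)
    have fin: "finite J"
      using J K finite_subset by blast
    \<comment> \<open>\<open>s1\<close> keeps the shrunken vectors admissible; \<open>s2\<close>
      secures the interference hypothesis of \<open>inverse_rate_shrink_le\<close>.\<close>
    obtain s1 where s1: "0 < s1" "s1 < 1" "\<And>k. k \<in> J \<Longrightarrow> c1 \<le> s1 * (norm (v k))\<^sup>2"
      using exists_shrink_factor[OF fin, of "\<lambda>_. c1" "\<lambda>k. (norm (v k))\<^sup>2"] long J(1) assms(4)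
      by (metis less_imp_le subset_iff)
    obtain s2 where s2: "0 < s2" "s2 < 1"
        "\<And>k. k \<in> J \<Longrightarrow> \<sigma>\<^sup>2 \<le> s2 * (\<Sum>l\<in>J - {k}. (v k \<bullet> v l)\<^sup>2)"
      using exists_shrink_factor[OF fin, of "\<lambda>_. \<sigma>\<^sup>2" "\<lambda>k. \<Sum>l\<in>J - {k}. (v k \<bullet> v l)\<^sup>2"] strong
      by (metis zero_le_power2)
    \<comment> \<open>Both conditions persist when the factor increases, so the larger one satisfies
      both and is still below 1.\<close>
    define s where "s = max s1 s2"
    have s: "0 < s" "s < 1"
      using s1 s2 by (auto simp: s_def)
    have s_norm: "c1 \<le> s * (norm (v k))\<^sup>2" if "k \<in> J" for k
      using s1(3)[OF that] mult_right_mono[of s1 s "(norm (v k))\<^sup>2"] by (simp add: s_def)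
    have s_strong: "\<sigma>\<^sup>2 \<le> s * (\<Sum>l\<in>J - {k}. (v k \<bullet> v l)\<^sup>2)" if "k \<in> J" for k
      using s2(3)[OF that] mult_right_mono[of s2 s "\<Sum>l\<in>J - {k}. (v k \<bullet> v l)\<^sup>2"]
      by (simp add: s_def sum_nonneg)
    define w where "w i = (if i \<in> J then sqrt s *\<^sub>R v i else v i)" for i
    have norm_w: "(norm (w i))\<^sup>2 = (if i \<in> J then s * (norm (v i))\<^sup>2 else (norm (v i))\<^sup>2)" for i
      using s by (simp add: w_def power_mult_distrib)
    have norm_w_le: "(norm (w i))\<^sup>2 \<le> (norm (v i))\<^sup>2" for i
      using s by (simp add: norm_w mult_left_le_one_le)
    have "admissible_system c1 c2 N w"
      unfolding admissible_system_def
    proof (intro ballI conjI)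
      fix i assume i: "i \<in> {1..N}"
      show "c1 \<le> (norm (w i))\<^sup>2"
        using adm i s_norm by (simp add: norm_w admissible_system_def)
      show "(norm (w i))\<^sup>2 \<le> c2"
        using adm i order_trans[OF norm_w_le[of i]] by (simp add: admissible_system_def)
    qed
    moreover have "max_inverse_rate \<sigma> N w \<le> max_inverse_rate \<sigma> N v"
      unfolding w_def using J(1) K(2) s s_strong
      by (intro max_inverse_rate_mono inverse_rate_shrink_le N) auto
    ultimately have "energy N v \<le> energy N w"
      by (rule least)
    \<comment> \<open>No norm rises, and since \<open>J\<close> is nonempty and its vectors are
      nonzero, at least one strictly falls.\<close>
    moreover have "energy N w < energy N v"
      unfolding energy_def
    proof (rule sum_strict_mono_ex1)
      obtain j where j: "j \<in> J"
        using J(2) by blast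
      then have "0 < (norm (v j))\<^sup>2"
        using long[of j] J(1) assms(4) by force
      then have "(norm (w j))\<^sup>2 < (norm (v j))\<^sup>2"
        using j s(2) by (simp add: norm_w)
      then show "\<exists>i\<in>{1..N}. (norm (w i))\<^sup>2 < (norm (v i))\<^sup>2"
        using j J(1) K(2) by blast
    qed (use norm_w_le in auto)
    ultimately show False
      by simp
  qed
  then have "real (card K) \<le> real CARD('d) * ((2 * \<sigma>\<^sup>2 + 2 * c2\<^sup>2 - c1\<^sup>2) / c1\<^sup>2)"
    using adm K assms(4,5)
    by (intro card_le_of_small_cross_energy[of K c1 c2 v]) (auto simp: admissible_system_def)
  moreover have "extremal_system b \<sigma> c1 c2 N v"
    using assms N adm best by (intro extremal_systemI) auto
  ultimately show ?thesis
    unfolding K_def by blast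
qed

end
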